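(* Let $m\ge 3$ be an integer and let $0<p<\frac{2^{m-1}+1}{m+1}$. For every ergodic dynamical system $\mathbf{X}=(X,\Sigma,\mu,T)$ with $(X,\Sigma,\mu)$ nonatomic, there are $2^m-1$ functions $F_\epsilon\in L^p(\mathbf{X})$, $\epsilon\in V_m=\{0,1\}^m\setminus\{\mathbf{0}\}$, such that $$\limsup_{N\to\infty}\frac{1}{N^m}\sum_{\vec{i}\in\{1,2,\ldots,N\}^m}\ \prod_{\epsilon\in V_m}F_\epsilon\bigl(T^{\vec{i}\cdot\epsilon}x\bigr)=\infty$$ for $\mu$-almost every $x\in X$.
   Context: A dynamical system $\mathbf{X}=(X,\Sigma,\mu,T)$ is a complete probability space $(X,\Sigma,\mu)$ together with an invertible, bimeasurable transformation $T:X\to X$ that preserves $\mu$, i.e. $\mu T^{-1}=\mu$. $L^p(\mathbf{X})$ denotes $L^p(X,\Sigma,\mu)$ (real-valued functions). For $\vec{i}=(i_1,\dots,i_m)\in\mathbb{Z}^m$ and $\epsilon=(\epsilon^{(1)},\dots,\epsilon^{(m)})\in\{0,1\}^m$, $\vec{i}\cdot\epsilon=\sum_{j=1}^m i_j\epsilon^{(j)}$ is the usual dot product. *)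

theory Defs
  imports "HOL-Probability.Probability"
begin

locale dynamical_system = prob_space M + complete_measure M
  for M :: "'a measure" and T :: "'a \<Rightarrow> 'a" +
  assumes bij: "bij_betw T (space M) (space M)"
    and measurable_T: "T \<in> measurable M M"
    and measurable_inv_T: "the_inv_into (space M) T \<in> measurable M M"
    and measure_preserving: "distr M M T = M"

definition ergodic :: "'a measure \<Rightarrow> ('a \<Rightarrow> 'a) \<Rightarrow> bool" where
  "ergodic M T \<longleftrightarrow>
     (\<forall>A\<in>sets M. T -` A \<inter> space M = A \<longrightarrow> measure M A = 0 \<or> measure M A = 1)"

definition nonatomic :: "'a measure \<Rightarrow> bool" where
  "nonatomic M \<longleftrightarrow>
     (\<forall>A\<in>sets M. emeasure M A > 0 \<longrightarrow>
        (\<exists>B\<in>sets M. B \<subseteq> A \<and> 0 < emeasure M B \<and> emeasure M B < emeasure M A))"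

text \<open>Membership of a representative in the real space \<open>L\<^sup>p\<close>, for \<open>0 < p < \<infinity>\<close>
  (values \<open>p < 1\<close> are allowed; note that \<open>0 powr p = 0\<close>).\<close>

definition in_Lp :: "real \<Rightarrow> 'a measure \<Rightarrow> ('a \<Rightarrow> real) \<Rightarrow> bool" where
  "in_Lp p M f \<longleftrightarrow>
     f \<in> borel_measurable M \<and> integrable M (\<lambda>x. \<bar>f x\<bar> powr p)"

text \<open>Vectors of length \<open>m\<close> are functions on \<open>{1..m}\<close>, extended by \<open>undefined\<close> outside
  (so that distinct functions are distinct vectors). All vectors that occur have nonnegative
  entries, hence the dot product is a natural number and \<open>T\<close> is iterated by \<open>^^\<close>.\<close>

definition V :: "nat \<Rightarrow> (nat \<Rightarrow> nat) set" where
  "V m = ({1..m} \<rightarrow>\<^sub>E {0, 1}) - {\<lambda>j\<in>{1..m}. 0}"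

definition dot :: "nat \<Rightarrow> (nat \<Rightarrow> nat) \<Rightarrow> (nat \<Rightarrow> nat) \<Rightarrow> nat" where
  "dot m i \<epsilon> = (\<Sum>j = 1..m. i j * \<epsilon> j)"

definition cubic_average ::
  "('a \<Rightarrow> 'a) \<Rightarrow> nat \<Rightarrow> ((nat \<Rightarrow> nat) \<Rightarrow> 'a \<Rightarrow> real) \<Rightarrow> nat \<Rightarrow> 'a \<Rightarrow> real" where
  "cubic_average T m F N x =
     (1 / real N ^ m) *
       (\<Sum>i\<in>{1..m} \<rightarrow>\<^sub>E {1..N}. \<Prod>\<epsilon>\<in>V m. F \<epsilon> ((T ^^ dot m i \<epsilon>) x))"

end

theory Submission
  imports Defs
begin

text \<open>
  One function with rare, very tall peaks does everything: take a suitable \<open>f \<ge> 0\<close> in \<open>L\<^sup>p\<close>,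
  put \<open>F\<^sub>\<epsilon> = f\<close> for the \<open>2\<^bsup>m-1\<^esup>\<close> vertices \<open>\<epsilon>\<close> of the cube with first coordinate \<open>1\<close>, and
  \<open>F\<^sub>\<epsilon> = 1\<close> for the others. All terms of the cubic average are nonnegative, so it is bounded
  below by any single one of them. For \<open>i = (q, 1, \<dots>, 1)\<close> the numbers \<open>i \<cdot> \<epsilon>\<close> that
  belong to these \<open>2\<^bsup>m-1\<^esup>\<close> vertices lie in the short window \<open>[q, q + m - 1]\<close>. If the orbit of \<open>x\<close> stays on a peak
  of height \<open>h\<close> during that window, and \<open>q \<le> N\<close>, the average is therefore at least
  \<open>h\<^sup>b / N\<^sup>m\<close> with \<open>b = 2\<^bsup>m-1\<^esup>\<close>.

  A weak form of Rokhlin's lemma makes the peaks both rare and unavoidable: for every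
  \<open>N\<close> some set \<open>A\<close> of measure at most \<open>2 / N\<close> is met by almost every orbit within \<open>N\<close> steps
  (\<open>ex_marker_set\<close>). The points that reach \<open>A\<close> within fewer than \<open>m\<close> steps form a
  set \<open>D\<close> of measure \<open>O(1 / N)\<close>, and the window of length \<open>m\<close> that ends with a visit to
  \<open>A\<close> is spent in \<open>D\<close>. A peak on \<open>D\<close> contributes \<open>O(h\<^sup>p / N)\<close> to the integral of \<open>f\<^sup>p\<close>, so \<open>h\<close> may
  almost be as large as \<open>N\<^bsup>1/p\<^esup>\<close>, which bounds the average below by almost \<open>N\<^bsup>b/p - m\<^esup>\<close>. This tends to
  infinity when \<open>p < 2\<^bsup>m-1\<^esup> / m\<close>, a range that contains
  \<open>p < (2\<^bsup>m-1\<^esup> + 1) / (m + 1)\<close> because \<open>m < 2\<^bsup>m-1\<^esup>\<close> for \<open>m \<ge> 3\<close> (\<open>peak_exponent\<close>).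

  One \<open>f\<close> must serve infinitely many scales. At scale \<open>n\<close> take \<open>N = 2\<^bsup>Kn\<^esup>\<close> and
  \<open>h\<^sup>p = 2\<^bsup>(K-1)n\<^esup>\<close>: the loss of the factor \<open>2\<^sup>n\<close> makes the integrals summable
  (\<open>ex_peak_function\<close>), and a large constant \<open>K\<close> makes that loss harmless. Every
  scale works for almost every point, so the limit superior is infinite almost everywhere.
\<close>

section \<open>Small sets and recurrence\<close>

context dynamical_system
begin

text \<open>A nonatomic set splits into two parts of positive measure, one of which has at most half
  of its measure.\<close>

lemma ex_small_positive_set:
  assumes "nonatomic M"
  shows "\<exists>E\<in>sets M. 0 < prob E \<and> prob E \<le> 1 / 2 ^ n"
proof (induction n)
  case 0
  then show ?case
    using prob_space by (intro bexI[of _ "space M"]) auto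
next
  case (Suc n)
  then obtain E where E: "E \<in> sets M" "0 < prob E" "prob E \<le> 1 / 2 ^ n"
    by blast
  then obtain B where "B \<in> sets M" "B \<subseteq> E" "0 < emeasure M B" "emeasure M B < emeasure M E"
    using assms unfolding nonatomic_def by (metis emeasure_eq_measure ennreal_less_zero_iff)
  then have B: "B \<in> sets M" "B \<subseteq> E" "0 < prob B" "prob B < prob E"
    by (auto simp: emeasure_eq_measure ennreal_less_iff)
  have diff: "prob (E - B) = prob E - prob B"
    using B E by (intro finite_measure_Diff) auto
  show ?case
  proof (cases "prob B \<le> prob E / 2")
    case True
    then show ?thesis
      using B E(3) by (intro bexI[of _ B]) auto
  next
    case False
    then show ?thesis
      using B E(1,3) diff by (intro bexI[of _ "E - B"]) auto
  qed
qed

lemma measurable_iterate [measurable]: "T ^^ n \<in> measurable M M"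
  by (rule measurable_compose_n[OF measurable_T])

lemma iterate_in_space: "x \<in> space M \<Longrightarrow> (T ^^ n) x \<in> space M"
  by (rule measurable_space[OF measurable_iterate])

lemma distr_iterate: "distr M M (T ^^ n) = M"
proof (induction n)
  case 0
  then show ?case
    by (simp add: distr_id2 id_def)
next
  case (Suc n)
  have "distr M M (T \<circ> T ^^ n) = distr (distr M M (T ^^ n)) M T"
    by (rule distr_distr[symmetric]) (use measurable_T in auto)
  then show ?case
    by (simp only: Suc measure_preserving funpow.simps)
qed

lemma prob_vimage_iterate:
  assumes "A \<in> sets M"
  shows "prob ((T ^^ n) -` A \<inter> space M) = prob A"
  using measure_distr[OF measurable_iterate assms, of n] by (simp add: distr_iterate)

lemma AE_iterate:
  assumes "AE x in M. P x"
  shows "AE x in M. P ((T ^^ n) x)"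
proof (rule AE_distrD[OF measurable_iterate])
  show "AE x in distr M M (T ^^ n). P x"
    unfolding distr_iterate by (rule assms)
qed

text \<open>The set of points that visit \<open>E\<close> at some time is only mapped into itself by the preimage, but
  the set of points that visit \<open>E\<close> infinitely often is strictly invariant. Since \<open>T\<close> preserves the
  measure, visiting \<open>E\<close> after time \<open>k\<close> has the same probability for all \<open>k\<close>, so the two sets have equal
  measure, and ergodicity applies.\<close>

lemma AE_visits:
  assumes erg: "ergodic M T" and E: "E \<in> sets M" and pos: "0 < prob E"
  shows "AE x in M. \<exists>n. (T ^^ n) x \<in> E"
proof -
  define G where "G k = {x\<in>space M. \<exists>n\<ge>k. (T ^^ n) x \<in> E}" for k
  have G [measurable]: "G k \<in> sets M" for k
    unfolding G_def using E by measurable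
  have shift: "(T ^^ k) -` G 0 \<inter> space M = G k" for k
  proof -
    have "(T ^^ n) ((T ^^ k) x) = (T ^^ (k + n)) x" for n x
      by (simp add: funpow_add flip: add.commute[of n k])
    then show ?thesis
      by (auto simp: G_def iterate_in_space le_iff_add)
  qed
  have "prob E \<le> prob (G 0)"
    using E sets.sets_into_space[OF E]
    by (intro finite_measure_mono) (auto simp: G_def intro!: exI[of _ 0])
  have "decseq G"
    by (auto simp: decseq_def G_def intro: order_trans)
  then have "(\<lambda>k. prob (G k)) \<longlonglongrightarrow> prob (\<Inter>k. G k)"
    by (intro finite_Lim_measure_decseq) auto
  moreover have "(\<lambda>k. prob (G k)) = (\<lambda>k. prob (G 0))"
    by (rule ext) (metis prob_vimage_iterate shift G)
  ultimately have lim: "prob (\<Inter>k. G k) = prob (G 0)"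
    by (metis LIMSEQ_unique tendsto_const)
  have "T -` (\<Inter>k. G k) \<inter> space M = (\<Inter>k. G k)"
  proof (intro set_eqI iffI)
    fix x assume x: "x \<in> T -` (\<Inter>k. G k) \<inter> space M"
    have "\<exists>n\<ge>k. (T ^^ n) x \<in> E" for k
    proof -
      obtain n where "n \<ge> k" "(T ^^ n) (T x) \<in> E"
        using x by (auto simp: G_def)
      then show ?thesis
        by (intro exI[of _ "Suc n"]) (simp add: funpow_Suc_right del: funpow.simps)
    qed
    then show "x \<in> (\<Inter>k. G k)"
      using x by (auto simp: G_def)
  next
    fix x assume x: "x \<in> (\<Inter>k. G k)"
    have sp: "x \<in> space M"
      using x by (auto simp: G_def)
    have "\<exists>n\<ge>k. (T ^^ n) (T x) \<in> E" for k
    proof -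
      obtain n where "n \<ge> Suc k" "(T ^^ n) x \<in> E"
        using x by (auto simp: G_def)
      then show ?thesis
        by (intro exI[of _ "n - 1"], cases n) (auto simp: funpow_Suc_right simp del: funpow.simps)
    qed
    then show "x \<in> T -` (\<Inter>k. G k) \<inter> space M"
      using sp measurable_space[OF measurable_T sp] by (auto simp: G_def)
  qed
  then have "prob (\<Inter>k. G k) = 0 \<or> prob (\<Inter>k. G k) = 1"
    using erg unfolding ergodic_def by (auto intro!: sets.countable_INT)
  then have "prob (G 0) = 1"
    using lim \<open>prob E \<le> prob (G 0)\<close> pos by auto
  then have "AE x in M. x \<in> G 0"
    by (simp add: AE_in_set_eq_1)
  then show ?thesis
    by eventually_elim (auto simp: G_def)
qed

section \<open>Marker sets\<close>

text \<open>Take \<open>E\<close> of positive measure at most \<open>1 / H\<^sup>2\<close> and let \<open>B j\<close> consist of the points whose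
  first visit to \<open>E\<close> happens at a time congruent to \<open>j\<close> modulo \<open>H\<close>. Away from \<open>E\<close>, one step along
  the orbit lowers the visiting time by one, so an orbit that visits \<open>E\<close> passes through \<open>B 0\<close> within \<open>H\<close> steps,
  and the disjoint sets \<open>B 0, \<dots>, B (H - 1)\<close> have nearly equal measure: consecutive ones differ
  by at most the measure of \<open>E\<close>. Hence the measure of \<open>B 0\<close> exceeds \<open>1 / H\<close> by at most a factor \<open>2\<close>.\<close>

lemma ex_marker_set:
  assumes erg: "ergodic M T" and na: "nonatomic M" and H: "0 < H"
  shows "\<exists>A\<in>sets M. prob A \<le> 2 / real H \<and> (AE x in M. \<exists>q<H. (T ^^ q) x \<in> A)"
proof -
  obtain E where E [measurable]: "E \<in> sets M" and pos: "0 < prob E"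
    and small2: "prob E \<le> 1 / 2 ^ (2 * H)"
    using ex_small_positive_set[OF na] by blast
  \<comment> \<open>The exponent \<open>2 * H\<close> is one that certainly gives \<open>2\<^bsup>2H\<^esup> \<ge> H\<^sup>2\<close>.\<close>
  have "real (H ^ 2) \<le> real ((2 ^ H) ^ 2)"
    unfolding of_nat_le_iff by (intro power_mono) (auto intro: less_imp_le)
  then have "prob E \<le> 1 / real H ^ 2"
    using H by (intro order_trans[OF small2] divide_left_mono) (auto simp: power_mult mult.commute)
  then have small: "real H * (real H * prob E) \<le> 1"
    using H by (simp add: field_simps power2_eq_square)
  define W where "W n = {x\<in>space M. (T ^^ n) x \<in> E \<and> (\<forall>i<n. (T ^^ i) x \<notin> E)}" for n
  define B where "B j = (\<Union>k. W (k * H + j))" for j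
  have W [measurable]: "W n \<in> sets M" for n
    unfolding W_def by measurable
  have B [measurable]: "B j \<in> sets M" for j
    unfolding B_def by measurable
  have W_unique: "n = n'" if "x \<in> W n" "x \<in> W n'" for x n n'
    using that by (auto simp: W_def) (metis linorder_neqE_nat)
  have W_pred: "x \<in> W (Suc n)" if "x \<in> space M" "T x \<in> W n" "x \<notin> E" for x n
  proof -
    have "(T ^^ i) x \<notin> E" if "i < Suc n" for i
      using that \<open>x \<notin> E\<close> \<open>T x \<in> W n\<close>
      by (cases i) (auto simp: W_def funpow_Suc_right simp del: funpow.simps(2))
    then show ?thesis
      using that by (auto simp: W_def funpow_Suc_right simp del: funpow.simps(2))
  qed
  have W_iter: "(T ^^ j) x \<in> W n" if "x \<in> W (n + j)" for x n j
  proof -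
    have "(T ^^ i) ((T ^^ j) x) = (T ^^ (i + j)) x" for i
      by (simp add: funpow_add)
    then show ?thesis
      using that by (auto simp: W_def iterate_in_space)
  qed
  have step: "prob (B j) \<le> prob (B (Suc j)) + prob E" for j
  proof -
    have "prob (B j) = prob ((T ^^ 1) -` B j \<inter> space M)"
      by (rule prob_vimage_iterate[symmetric]) simp
    also have "\<dots> \<le> prob (B (Suc j) \<union> E)"
      using W_pred by (intro finite_measure_mono) (auto simp: B_def)
    also have "\<dots> \<le> prob (B (Suc j)) + prob E"
      by (intro measure_Un_le) auto
    finally show ?thesis .
  qed
  have le: "prob (B 0) \<le> prob (B j) + real j * prob E" for j
  proof (induction j)
    case (Suc j)
    then show ?case
      using step[of j] by (simp add: algebra_simps)
  qed simp
  have disj: "disjoint_family_on B {..<H}"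
  proof (unfold disjoint_family_on_def, intro ballI impI)
    fix j j' assume j: "j \<in> {..<H}" "j' \<in> {..<H}" "j \<noteq> j'"
    have False if "x \<in> W (k * H + j)" "x \<in> W (k' * H + j')" for x k k'
    proof -
      have "(k * H + j) mod H = (k' * H + j') mod H"
        using W_unique[OF that] by simp
      then show False
        using j by simp
    qed
    then show "B j \<inter> B j' = {}"
      by (auto simp: B_def)
  qed
  have "real H * prob (B 0) = (\<Sum>j<H. prob (B 0))"
    by simp
  also have "\<dots> \<le> (\<Sum>j<H. prob (B j) + real H * prob E)"
  proof (rule sum_mono)
    fix j assume "j \<in> {..<H}"
    then have "real j * prob E \<le> real H * prob E"
      by (intro mult_right_mono) auto
    then show "prob (B 0) \<le> prob (B j) + real H * prob E"
      using le[of j] by linarith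
  qed
  also have "\<dots> = prob (\<Union>j<H. B j) + real H * (real H * prob E)"
    using finite_measure_finite_Union[OF _ _ disj] by (simp add: sum.distrib image_subset_iff)
  also have "\<dots> \<le> 1 + 1"
    using small by (intro add_mono) auto
  finally have "prob (B 0) \<le> 2 / real H"
    using H by (simp add: field_simps)
  moreover have "AE x in M. \<exists>q<H. (T ^^ q) x \<in> B 0"
    using AE_visits[OF erg E pos] AE_space
  proof eventually_elim
    case (elim x)
    define n where "n = (LEAST n. (T ^^ n) x \<in> E)"
    have "x \<in> W n"
      using elim LeastI_ex[of "\<lambda>n. (T ^^ n) x \<in> E"] not_less_Least
      by (fastforce simp: W_def n_def)
    then have "(T ^^ (n mod H)) x \<in> W (n div H * H + 0)"
      by (intro W_iter) simp
    then show ?case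
      using H by (intro exI[of _ "n mod H"]) (auto simp: B_def)
  qed
  ultimately show ?thesis
    using B by blast
qed

section \<open>An integrable function with tall peaks\<close>

text \<open>The peak of scale \<open>n\<close> has height \<open>2\<^bsup>n(K-1)/p\<^esup>\<close> and lies over a set \<open>D n\<close> of measure
  at most \<open>2m / 2\<^bsup>Kn\<^esup>\<close>, so the \<open>p\<close>-th powers of the peaks have integrals at most \<open>2m / 2\<^sup>n\<close>.
  It is \<open>f\<^sup>p\<close>, not \<open>f\<close>, that is defined as a sum over the scales: then
  the integrals simply add up, for \<open>p < 1\<close> as for \<open>p \<ge> 1\<close>.\<close>

lemma ex_peak_function:
  assumes erg: "ergodic M T" and na: "nonatomic M" and p: "0 < p"
  shows "\<exists>f. (\<forall>x. 0 \<le> f x) \<and> in_Lp p M f \<and>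
    (AE x in M. \<forall>n. \<exists>q. 1 \<le> q \<and> q \<le> 2 ^ (K * n) \<and>
       (\<forall>l<m. 2 powr (n * (real K - 1) / p) \<le> f ((T ^^ (q + l)) x)))"
proof -
  define H :: "nat \<Rightarrow> nat" where "H n = 2 ^ (K * n)" for n
  have "\<exists>A. A \<in> sets M \<and> prob A \<le> 2 / real (H n) \<and> (AE x in M. \<exists>q<H n. (T ^^ q) x \<in> A)" for n
    using ex_marker_set[OF erg na, of "H n"] unfolding Bex_def by (simp add: H_def)
  then have "\<forall>n. \<exists>A. A \<in> sets M \<and> prob A \<le> 2 / real (H n) \<and> (AE x in M. \<exists>q<H n. (T ^^ q) x \<in> A)"
    by (rule allI)
  from choice[OF this] obtain A where A [measurable]: "\<And>n. A n \<in> sets M"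
    and prob_A: "\<And>n. prob (A n) \<le> 2 / real (H n)"
    and hit: "\<And>n. AE x in M. \<exists>q<H n. (T ^^ q) x \<in> A n"
    by blast
  define D where "D n = (\<Union>l<m. (T ^^ l) -` A n \<inter> space M)" for n
  have D [measurable]: "D n \<in> sets M" for n
    unfolding D_def by (intro sets.finite_UN measurable_sets[OF measurable_iterate] A) simp
  define c where "c n = 2 powr (n * (real K - 1))" for n :: nat
  have c_H: "c n * (2 / real (H n)) = 2 * (1 / 2) ^ n" for n
  proof -
    have "real (H n) = 2 powr (n * real K)"
      by (simp add: H_def powr_realpow mult.commute flip: of_nat_mult)
    moreover have "c n = 2 powr (n * real K) / 2 ^ n"
      by (simp add: c_def right_diff_distrib powr_diff powr_realpow)
    ultimately show ?thesis
      by (simp add: power_one_over)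
  qed
  have prob_D: "prob (D n) \<le> m * (2 / real (H n))" for n
  proof -
    have "prob (D n) \<le> (\<Sum>l<m. prob ((T ^^ l) -` A n \<inter> space M))"
      unfolding D_def by (intro finite_measure_subadditive_finite) auto
    also have "\<dots> = m * prob (A n)"
      by (simp add: prob_vimage_iterate)
    finally show ?thesis
      using prob_A[of n] by (meson mult_left_mono of_nat_0_le_iff order_trans)
  qed
  define u where "u n x = c n * indicator (D n) x" for n and x :: 'a
  have c_pos: "0 < c n" for n
    by (simp add: c_def)
  have u_meas [measurable]: "u n \<in> borel_measurable M" for n
    unfolding u_def by measurable
  have u_nonneg: "0 \<le> u n x" for n x
    using c_pos by (simp add: u_def less_imp_le)
  have u_int: "integrable M (u n)" for n
    unfolding u_def by (intro integrable_mult_right integrable_real_indicator)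
      (auto simp: emeasure_eq_measure)
  have "(\<integral>x. norm (u n x) \<partial>M) \<le> 2 * m * (1 / 2) ^ n" for n
  proof -
    have "(\<integral>x. norm (u n x) \<partial>M) = c n * prob (D n)"
      using u_nonneg by (simp add: u_def)
    also have "\<dots> \<le> m * (c n * (2 / real (H n)))"
      using mult_left_mono[OF prob_D, of "c n" n] c_pos[of n] by (simp add: mult.left_commute)
    also have "\<dots> = 2 * m * (1 / 2) ^ n"
      unfolding c_H by simp
    finally show ?thesis .
  qed
  then have "norm (\<integral>x. norm (u n x) \<partial>M) \<le> 2 * m * (1 / 2) ^ n" for n
    by simp
  moreover have "summable (\<lambda>n. 2 * m * (1 / 2 :: real) ^ n)"
    by (rule summable_mult) (simp add: summable_geometric)
  ultimately have sum_int: "summable (\<lambda>n. \<integral>x. norm (u n x) \<partial>M)"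
    by (rule summable_comparison_test'[rotated])
  have AE_sum: "AE x in M. summable (\<lambda>n. u n x)"
  proof -
    have ennreal_meas: "(\<lambda>x. ennreal (u n x)) \<in> borel_measurable M" for n
      by measurable
    have "(\<integral>\<^sup>+x. (\<Sum>n. ennreal (u n x)) \<partial>M) = (\<Sum>n. \<integral>\<^sup>+x. ennreal (u n x) \<partial>M)"
      by (rule nn_integral_suminf[OF ennreal_meas])
    also have "\<dots> = (\<Sum>n. ennreal (\<integral>x. norm (u n x) \<partial>M))"
    proof (rule suminf_cong)
      fix n
      show "(\<integral>\<^sup>+x. ennreal (u n x) \<partial>M) = ennreal (\<integral>x. norm (u n x) \<partial>M)"
        using nn_integral_eq_integral[OF u_int[of n]] u_nonneg by simp
    qed
    also have "\<dots> \<noteq> \<infinity>"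
      unfolding infinity_ennreal_def by (rule ennreal_suminf_neq_top[OF sum_int]) simp
    finally have "AE x in M. (\<Sum>n. ennreal (u n x)) \<noteq> \<infinity>"
      by (rule nn_integral_PInf_AE[OF borel_measurable_suminf_order[OF ennreal_meas]])
    then show ?thesis
    proof eventually_elim
      case (elim x)
      then show ?case
        by (intro summable_suminf_not_top u_nonneg) simp
    qed
  qed
  \<comment> \<open>On the null set where the series diverges, its sum is an arbitrary real number; the
    absolute value makes \<open>f\<^sup>p\<close> equal to the modulus of the sum even there.\<close>
  define f where "f x = \<bar>\<Sum>n. u n x\<bar> powr (1 / p)" for x
  have f_meas: "f \<in> borel_measurable M"
    unfolding f_def by measurable
  have "integrable M (\<lambda>x. \<Sum>n. u n x)"
    using AE_sum u_nonneg by (intro integrable_suminf u_int sum_int) simp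
  moreover have "\<bar>f x\<bar> powr p = \<bar>\<Sum>n. u n x\<bar>" for x
    using p by (simp add: f_def powr_powr)
  ultimately have "in_Lp p M f"
    unfolding in_Lp_def using f_meas by simp
  moreover have "AE x in M. \<forall>n. \<exists>q. 1 \<le> q \<and> q \<le> 2 ^ (K * n) \<and>
       (\<forall>l<m. 2 powr (n * (real K - 1) / p) \<le> f ((T ^^ (q + l)) x))"
  proof -
    \<comment> \<open>A visit to \<open>A n\<close> at a time \<open>q + m\<close> with \<open>q \<ge> 0\<close> leaves room for the window
      \<open>q + 1, \<dots>, q + m\<close> of times in \<open>D n\<close> that ends with it.\<close>
    have "AE x in M. \<forall>n. \<exists>q<H n. (T ^^ q) ((T ^^ m) x) \<in> A n"
      unfolding AE_all_countable by (intro allI AE_iterate hit)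
    moreover have "AE x in M. \<forall>k. summable (\<lambda>n. u n ((T ^^ k) x))"
      unfolding AE_all_countable by (intro allI AE_iterate AE_sum)
    ultimately show ?thesis
      using AE_space
    proof eventually_elim
      case (elim x)
      show ?case
      proof
        fix n
        obtain q where q: "q < H n" "(T ^^ (q + m)) x \<in> A n"
          using elim(1) by (auto simp: funpow_add)
        have "2 powr (n * (real K - 1) / p) \<le> f ((T ^^ (Suc q + l)) x)" if "l < m" for l
        proof -
          let ?y = "(T ^^ (Suc q + l)) x"
          have "(T ^^ (m - Suc l)) ?y = (T ^^ (m - Suc l + (Suc q + l))) x"
            by (simp only: funpow_add comp_apply)
          also have "m - Suc l + (Suc q + l) = q + m"
            using that by simp
          finally have "?y \<in> D n"
            using q that elim(3) iterate_in_space
            by (auto simp: D_def simp del: funpow.simps intro!: bexI[of _ "m - Suc l"])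
          then have "c n = u n ?y"
            by (simp add: u_def)
          also have "\<dots> \<le> (\<Sum>n. u n ?y)"
            using sum_le_suminf[of "\<lambda>n. u n ?y" "{n}"] spec[OF elim(2), of "Suc q + l"] u_nonneg
            by simp
          also have "\<dots> \<le> \<bar>\<Sum>n. u n ?y\<bar>"
            by simp
          finally have "c n powr (1 / p) \<le> f ?y"
            unfolding f_def using p c_pos[of n] by (intro powr_mono2) (auto simp: less_imp_le)
          then show ?thesis
            by (simp add: c_def powr_powr)
        qed
        then show "\<exists>q. 1 \<le> q \<and> q \<le> 2 ^ (K * n) \<and>
            (\<forall>l<m. 2 powr (n * (real K - 1) / p) \<le> f ((T ^^ (q + l)) x))"
          using q by (intro exI[of _ "Suc q"]) (auto simp: H_def)
      qed
    qed
  qed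
  moreover have "\<forall>x. 0 \<le> f x"
    by (simp add: f_def)
  ultimately show ?thesis
    by blast
qed

end

section \<open>Cubic averages\<close>

lemma card_V_facet:
  assumes "1 \<le> m"
  shows "card {\<epsilon>\<in>V m. \<epsilon> 1 = 1} = 2 ^ (m - 1)"
proof -
  let ?P = "PiE {1..m} (\<lambda>j. if j = 1 then {1} else {0, 1::nat})"
  have one: "1 \<in> {1..m}"
    using assms by simp
  have "\<epsilon> \<in> V m \<and> \<epsilon> 1 = 1 \<longleftrightarrow> \<epsilon> \<in> ?P" for \<epsilon>
  proof
    assume "\<epsilon> \<in> V m \<and> \<epsilon> 1 = 1"
    then show "\<epsilon> \<in> ?P"
      by (simp add: V_def PiE_iff)
  next
    assume \<epsilon>: "\<epsilon> \<in> ?P"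
    have "\<epsilon> 1 = 1"
      using PiE_mem[OF \<epsilon> one] by simp
    moreover from this have "\<epsilon> \<noteq> (\<lambda>j\<in>{1..m}. 0)"
      using one by (metis restrict_apply' zero_neq_one)
    moreover have "\<epsilon> \<in> {1..m} \<rightarrow>\<^sub>E {0, 1}"
      using \<epsilon> by (rule subsetD[OF PiE_mono, rotated]) simp
    ultimately show "\<epsilon> \<in> V m \<and> \<epsilon> 1 = 1"
      unfolding V_def by simp
  qed
  then have "{\<epsilon>\<in>V m. \<epsilon> 1 = 1} = ?P"
    by blast
  also have "card ?P = (\<Prod>j\<in>{1..m}. card (if j = 1 then {1} else {0, 1::nat}))"
    by (rule card_PiE) simp
  also have "\<dots> = (\<Prod>j\<in>{1..m} - {1}. 2)"
    using one by (subst prod.remove[OF _ one]) (auto simp: numeral_2_eq_2 intro!: prod.cong)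
  also have "\<dots> = 2 ^ (m - 1)"
    using one by (simp add: card_Diff_singleton)
  finally show ?thesis .
qed

text \<open>Only the term \<open>i = (q, 1, \<dots>, 1)\<close> is kept. There \<open>i \<cdot> \<epsilon> = q + l\<close>, where
  \<open>l < m\<close> counts the nonzero coordinates of \<open>\<epsilon>\<close> after the first.\<close>

lemma cubic_average_ge:
  assumes m: "1 \<le> m" and f: "\<And>x. 0 \<le> f x" and q: "1 \<le> q" "q \<le> N" and "0 \<le> h"
    and peak: "\<And>l. l < m \<Longrightarrow> h \<le> f ((T ^^ (q + l)) x)"
  shows "h ^ 2 ^ (m - 1) / real N ^ m
           \<le> cubic_average T m (\<lambda>\<epsilon>. if \<epsilon> 1 = 1 then f else (\<lambda>_. 1)) N x"
proof -
  let ?F = "\<lambda>\<epsilon>::nat \<Rightarrow> nat. if \<epsilon> 1 = 1 then f else (\<lambda>_. 1)"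
  define i :: "nat \<Rightarrow> nat" where "i = (\<lambda>j\<in>{1..m}. if j = 1 then q else 1)"
  have i: "i \<in> {1..m} \<rightarrow>\<^sub>E {1..N}"
    using q unfolding i_def by (intro restrict_PiE_iff[THEN iffD2]) simp
  have fin: "finite (V m)"
    unfolding V_def by (intro finite_Diff finite_PiE) auto
  have "h \<le> f ((T ^^ dot m i \<epsilon>) x)" if "\<epsilon> \<in> V m" "\<epsilon> 1 = 1" for \<epsilon>
  proof -
    have "dot m i \<epsilon> = q + (\<Sum>j\<in>{1..m} - {1}. \<epsilon> j)"
      unfolding dot_def using m that(2) by (subst sum.remove[of _ 1]) (simp_all add: i_def)
    moreover have "(\<Sum>j\<in>{1..m} - {1}. \<epsilon> j) \<le> (\<Sum>j\<in>{1..m} - {1}. 1)"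
    proof (rule sum_mono)
      fix j assume "j \<in> {1..m} - {1}"
      then have "\<epsilon> j \<in> {0, 1}"
        using that(1) unfolding V_def by blast
      then show "\<epsilon> j \<le> 1"
        by auto
    qed
    then have "(\<Sum>j\<in>{1..m} - {1}. \<epsilon> j) < m"
      using m by simp
    ultimately show ?thesis
      using peak by simp
  qed
  then have "(\<Prod>\<epsilon>\<in>{\<epsilon>\<in>V m. \<epsilon> 1 = 1}. h) \<le> (\<Prod>\<epsilon>\<in>{\<epsilon>\<in>V m. \<epsilon> 1 = 1}. f ((T ^^ dot m i \<epsilon>) x))"
    using \<open>0 \<le> h\<close> by (intro prod_mono) blast
  also have "\<dots> = (\<Prod>\<epsilon>\<in>V m. ?F \<epsilon> ((T ^^ dot m i \<epsilon>) x))"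
    using fin by (intro prod.mono_neutral_cong_left) simp_all
  also have "\<dots> \<le> (\<Sum>i\<in>{1..m} \<rightarrow>\<^sub>E {1..N}. \<Prod>\<epsilon>\<in>V m. ?F \<epsilon> ((T ^^ dot m i \<epsilon>) x))"
  proof (rule member_le_sum[where f = "\<lambda>i. \<Prod>\<epsilon>\<in>V m. ?F \<epsilon> ((T ^^ dot m i \<epsilon>) x)", OF i])
    show "0 \<le> (\<Prod>\<epsilon>\<in>V m. ?F \<epsilon> ((T ^^ dot m j \<epsilon>) x))" for j
      by (rule prod_nonneg) (simp add: f)
    show "finite ({1..m} \<rightarrow>\<^sub>E {1..N})"
      by (intro finite_PiE) simp_all
  qed
  finally have "h ^ 2 ^ (m - 1) \<le> (\<Sum>i\<in>{1..m} \<rightarrow>\<^sub>E {1..N}. \<Prod>\<epsilon>\<in>V m. ?F \<epsilon> ((T ^^ dot m i \<epsilon>) x))"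
    unfolding prod_constant card_V_facet[OF m] .
  then show ?thesis
    unfolding cubic_average_def by (simp only: divide_right_mono mult_1 times_divide_eq_left
      of_nat_0_le_iff zero_le_power)
qed

lemma limsup_eq_infinity:
  fixes a :: "nat \<Rightarrow> real"
  assumes "strict_mono r" and "\<And>n. real n \<le> a (r n)"
  shows "limsup (\<lambda>N. ereal (a N)) = \<infinity>"
proof -
  have "filterlim (\<lambda>n. a (r n)) at_top sequentially"
    by (rule filterlim_at_top_mono[OF filterlim_real_sequentially always_eventually]) (simp add: assms(2))
  then have "(\<lambda>n. ereal (a (r n))) \<longlonglongrightarrow> \<infinity>"
    by (simp add: tendsto_PInfty_eq_at_top)
  then have "limsup ((\<lambda>N. ereal (a N)) \<circ> r) = \<infinity>"
    unfolding comp_def by (rule lim_imp_Limsup[OF sequentially_bot])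
  then show ?thesis
    using limsup_subseq_mono[OF assms(1), of "\<lambda>N. ereal (a N)"] by simp
qed

text \<open>The peaks beat the normalisation \<open>N\<^sup>m\<close> when \<open>p < 2\<^bsup>m-1\<^esup> / m\<close>. For \<open>m < b\<close> the fraction
  \<open>(b + 1) / (m + 1)\<close> is less than \<open>b / m\<close>; here \<open>b = 2\<^bsup>m-1\<^esup>\<close>.\<close>

lemma peak_exponent:
  fixes m :: nat
  assumes m: "m \<ge> 3" and p: "0 < p" "p < (2 ^ (m - 1) + 1) / (real m + 1)"
  shows "real m < 2 ^ (m - 1) / p"
proof -
  have "m < 2 ^ (m - 1)"
    using m
  proof (induction m rule: dec_induct)
    case (step n)
    then show ?case by (cases n) auto
  qed simp
  then have "real m < 2 ^ (m - 1)"
    using of_nat_less_iff[of m "2 ^ (m - 1)", where 'a = real] by simp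
  have "real m * p * (real m + 1) < real m * (2 ^ (m - 1) + 1)"
    using p m unfolding mult.assoc by (intro mult_strict_left_mono) (auto simp: pos_less_divide_eq)
  also have "\<dots> \<le> 2 ^ (m - 1) * (real m + 1)"
    using \<open>real m < 2 ^ (m - 1)\<close> by (simp add: algebra_simps)
  finally have "real m * p < 2 ^ (m - 1)"
    by simp
  then show ?thesis
    using p by (simp add: field_simps)
qed

theorem theorem2p6:
  fixes m :: nat and p :: real and M :: "'a measure" and T :: "'a \<Rightarrow> 'a"
  assumes "m \<ge> 3"
    and "0 < p" and "p < (2 ^ (m - 1) + 1) / (real m + 1)"
    and "dynamical_system M T" and "ergodic M T" and "nonatomic M"
  shows "\<exists>F :: (nat \<Rightarrow> nat) \<Rightarrow> 'a \<Rightarrow> real.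
    (\<forall>\<epsilon>\<in>V m. in_Lp p M (F \<epsilon>)) \<and>
    (AE x in M. limsup (\<lambda>N. ereal (cubic_average T m F N x)) = \<infinity>)"
proof -
  interpret dynamical_system M T
    by fact
  define a where "a = 2 ^ (m - 1) / p"
  have a: "real m < a"
    unfolding a_def using assms(1-3) by (rule peak_exponent)
  \<comment> \<open>At scale \<open>n\<close> the lower bound for the average is
    \<open>2\<^bsup>n((K-1)a - Km)\<^esup> = 2\<^bsup>n(K(a-m) - a)\<^esup>\<close>, so it is at least \<open>2\<^sup>n\<close> once \<open>K(a - m) > a + 1\<close>.\<close>
  obtain K :: nat where "(a + 1) / (a - m) < K"
    using reals_Archimedean2 by blast
  then have K: "a + 1 < K * (a - m)"
    using a by (simp add: field_simps)
  have "K \<noteq> 0"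
    using K a by (intro notI) auto
  obtain f where f: "\<And>x. 0 \<le> f x" "in_Lp p M f"
    and peak: "AE x in M. \<forall>n. \<exists>q. 1 \<le> q \<and> q \<le> 2 ^ (K * n) \<and>
       (\<forall>l<m. 2 powr (n * (real K - 1) / p) \<le> f ((T ^^ (q + l)) x))"
    using ex_peak_function[OF assms(5,6,2), of K m] by blast
  define F where "F = (\<lambda>\<epsilon>::nat \<Rightarrow> nat. if \<epsilon> 1 = 1 then f else (\<lambda>_. 1))"
  have "in_Lp p M (F \<epsilon>)" for \<epsilon>
    using f(2) by (auto simp: F_def in_Lp_def)
  moreover have "AE x in M. limsup (\<lambda>N. ereal (cubic_average T m F N x)) = \<infinity>"
    using peak
  proof eventually_elim
    case (elim x)
    have "real n \<le> cubic_average T m F (2 ^ (K * n)) x" for n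
    proof -
      let ?h = "2 powr (n * (real K - 1) / p)"
      obtain q where "1 \<le> q" "q \<le> 2 ^ (K * n)" "\<And>l. l < m \<Longrightarrow> ?h \<le> f ((T ^^ (q + l)) x)"
        using elim by blast
      then have ge: "?h ^ 2 ^ (m - 1) / real (2 ^ (K * n)) ^ m
          \<le> cubic_average T m F (2 ^ (K * n)) x"
        unfolding F_def using assms(1) f(1) by (intro cubic_average_ge) auto
      have "real n \<le> 2 ^ n"
        by (simp add: less_imp_le)
      also have "\<dots> = 2 powr (real n * 1)"
        by (simp add: powr_realpow)
      also have "\<dots> \<le> 2 powr (n * (K * (a - m) - a))"
        using K by (intro powr_mono mult_left_mono) auto
      also have "\<dots> = 2 powr (n * (real K - 1) * a) / 2 powr (K * n * m)"
        unfolding powr_diff[symmetric] by (simp add: algebra_simps)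
      also have "2 powr (n * (real K - 1) * a) = ?h ^ 2 ^ (m - 1)"
        by (simp add: a_def powr_power mult_ac)
      also have "2 powr (K * n * m) = real (2 ^ (K * n)) ^ m"
        by (simp only: powr_realpow[of 2 "K * n * m"] power_mult of_nat_power of_nat_numeral zero_less_numeral)
      finally show ?thesis
        using ge by linarith
    qed
    moreover have "strict_mono (\<lambda>n. 2 ^ (K * n) :: nat)"
      using \<open>K \<noteq> 0\<close> by (auto simp: strict_mono_def)
    ultimately show ?case
      by (intro limsup_eq_infinity)
  qed
  ultimately show ?thesis
    by blast
qed

end
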